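(* Let $m, n$ be positive integers with $m \leq n$. Then \[ \gamma(Q_{m \times n}) \geq \min \left\{ m, \left\lceil \frac{m+n-2}{4} \right\rceil \right\}. \]
   Context: The $m \times n$ chessboard has squares $(x,y)$ with $1 \le x \le n$ (column $x$) and $1 \le y \le m$ (row $y$). The queens graph $Q_{m \times n}$ has these squares as vertices; two distinct squares are adjacent if they lie in the same row, the same column, the same difference diagonal (same value of $y-x$) or the same sum diagonal (same value of $y+x$). A set $D$ of squares is a dominating set if every square is in $D$ or adjacent to a square of $D$; $\gamma(Q_{m \times n})$ denotes the minimum size of a dominating set. *)

theory Defs
  imports Complex_Main "Graph_Theory.Pair_Digraph"
begin

text \<open>
  An undirected graph is a \<^locale>\<open>pair_graph\<close>: a finite, loop-free, symmetric digraph whose arcs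
  are pairs of vertices. A square is a pair \<open>(x, y)\<close> with column \<open>x\<close> first. Coordinates
  are integers so that \<open>y - x\<close> is not truncated.
\<close>

definition squares :: "nat \<Rightarrow> nat \<Rightarrow> (int \<times> int) set" where
  "squares m n = {1..int n} \<times> {1..int m}"

definition queens_adj :: "int \<times> int \<Rightarrow> int \<times> int \<Rightarrow> bool" where
  "queens_adj s t \<longleftrightarrow> s \<noteq> t \<and>
     (snd s = snd t \<or> fst s = fst t \<or> snd s - fst s = snd t - fst t \<or> snd s + fst s = snd t + fst t)"

definition queens_graph :: "nat \<Rightarrow> nat \<Rightarrow> (int \<times> int) pair_pre_digraph" where
  "queens_graph m n =
     \<lparr> pverts = squares m n,
       parcs = {(s, t). s \<in> squares m n \<and> t \<in> squares m n \<and> queens_adj s t} \<rparr>"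

definition dominating_set :: "'a pair_pre_digraph \<Rightarrow> 'a set \<Rightarrow> bool" where
  "dominating_set G D \<longleftrightarrow>
     D \<subseteq> pverts G \<and> (\<forall>v \<in> pverts G. v \<in> D \<or> (\<exists>u \<in> D. (u, v) \<in> parcs G))"

text \<open>\<open>finite D\<close> is automatic for a finite graph; it is there because \<^const>\<open>card\<close> of an infinite set is 0.\<close>

definition domination_number :: "'a pair_pre_digraph \<Rightarrow> nat" where
  "domination_number G = (LEAST k. \<exists>D. finite D \<and> dominating_set G D \<and> card D = k)"

lemma finite_squares: "finite (squares m n)"
  by (simp add: squares_def)

lemma queens_adj_sym: "queens_adj s t \<longleftrightarrow> queens_adj t s"
  unfolding queens_adj_def by metis

lemma pair_graph_queens_graph: "pair_graph (queens_graph m n)"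
proof
  show "finite (pverts (queens_graph m n))"
    by (simp add: queens_graph_def finite_squares)
  have "parcs (queens_graph m n) \<subseteq> squares m n \<times> squares m n"
    by (auto simp: queens_graph_def)
  then show "finite (parcs (queens_graph m n))"
    by (rule finite_subset) (simp add: finite_squares)
  show "symmetric (with_proj (queens_graph m n))"
    by (auto simp: symmetric_def sym_def queens_graph_def arcs_ends_def arc_to_ends_def
        image_iff queens_adj_sym)
qed (auto simp: queens_graph_def queens_adj_def)

lemma domination_number_attained:
  assumes "finite (pverts G)"
  shows "\<exists>D. finite D \<and> dominating_set G D \<and> card D = domination_number G"
  unfolding domination_number_def
  by (rule LeastI_ex) (use assms in \<open>auto simp: dominating_set_def\<close>)

lemma domination_number_le:
  assumes "finite D" "dominating_set G D"
  shows "domination_number G \<le> card D"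
  unfolding domination_number_def by (rule Least_le) (use assms in blast)

end

theory Submission
  imports Defs
begin

text \<open>
  Suppose a dominating set \<open>D\<close> has fewer than \<open>m\<close> squares. Let \<open>a\<close>, \<open>b\<close> be the first and last column
  and \<open>c\<close>, \<open>d\<close> the first and last row without a queen, and consider the boundary of the box
  \<open>[a, b] \<times> [c, d]\<close>, which consists of \<open>2(b - a) + 2(d - c)\<close> squares. Each of the four lines
  through a queen meets the boundary at most twice, the column of a queen outside the columns
  \<open>a..b\<close> misses it, and so does the row of a queen outside the rows \<open>c..d\<close>. So a queen attacks at
  most 8 boundary squares, less 2 for being outside the columns and less 2 for being outside the
  rows. At least \<open>n - (b - a) - 1\<close> queens are outside the columns
  and at least \<open>m - (d - c) - 1\<close> outside the rows. Summing over all queens gives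
  \<open>8 |D| \<ge> 2 (m + n - 2)\<close>.

  The boundary is split into four half-open sides, counted with multiplicity, so that the argument
  also covers degenerate boxes with \<open>a = b\<close> or \<open>c = d\<close>.
\<close>

lemma card_Int_triple_le:
  "int (card (A \<inter> {u, v, w}))
     \<le> of_bool (u \<in> A) + of_bool (v \<in> A) + of_bool (w \<in> A)"
proof -
  have "A \<inter> {u, v, w} = A \<inter> {u} \<union> (A \<inter> {v} \<union> A \<inter> {w})" by blast
  moreover have "card (A \<inter> {z}) = of_bool (z \<in> A)" for z by (cases "z \<in> A") auto
  ultimately show ?thesis
    using card_Un_le[of "A \<inter> {u}" "A \<inter> {v} \<union> A \<inter> {w}"] card_Un_le[of "A \<inter> {v}" "A \<inter> {w}"]
    by auto
qed

text \<open>Off its own row, a queen reaches row \<open>r\<close> only along its column and its two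
  diagonals, each in one square.\<close>

lemma card_attacked_in_row_le:
  assumes "snd q \<noteq> r"
  shows "int (card {x \<in> A. queens_adj q (x, r)})
           \<le> of_bool (fst q \<in> A) + of_bool (fst q + r - snd q \<in> A) + of_bool (fst q + snd q - r \<in> A)"
proof -
  have "{x \<in> A. queens_adj q (x, r)} \<subseteq> A \<inter> {fst q, fst q + r - snd q, fst q + snd q - r}"
    using assms by (auto simp: queens_adj_def)
  then have "card {x \<in> A. queens_adj q (x, r)}
               \<le> card (A \<inter> {fst q, fst q + r - snd q, fst q + snd q - r})"
    by (intro card_mono) auto
  with card_Int_triple_le[of A "fst q" "fst q + r - snd q" "fst q + snd q - r"]
  show ?thesis by linarith
qed

lemma queens_adj_swap: "queens_adj (prod.swap s) (prod.swap t) \<longleftrightarrow> queens_adj s t"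
  by (cases s; cases t) (auto simp: queens_adj_def)

lemma card_attacked_in_column_le:
  assumes "fst q \<noteq> k"
  shows "int (card {y \<in> A. queens_adj q (k, y)})
           \<le> of_bool (snd q \<in> A) + of_bool (snd q + k - fst q \<in> A) + of_bool (snd q + fst q - k \<in> A)"
  using card_attacked_in_row_le[of "prod.swap q" k A] assms queens_adj_swap[of q "(k, _)"]
  by simp

lemma attacked_boundary_le:
  fixes a b c d :: int
  assumes "fst q \<noteq> a" "fst q \<noteq> b" "snd q \<noteq> c" "snd q \<noteq> d"
  shows "int (card {x \<in> {a..<b}. queens_adj q (x, c)}) + int (card {x \<in> {a<..b}. queens_adj q (x, d)})
       + int (card {y \<in> {c<..d}. queens_adj q (a, y)}) + int (card {y \<in> {c..<d}. queens_adj q (b, y)})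
       + 2 * of_bool (fst q \<notin> {a..b}) + 2 * of_bool (snd q \<notin> {c..d}) \<le> 8"
proof -
  define p where "p = fst q"
  define r where "r = snd q"
  \<comment> \<open>The last four bounds pair the two sides at one corner: a diagonal crossing that
    corner meets at most one of them, since each corner belongs to a single half-open side.\<close>
  have "of_bool (p \<in> {a..<b}) + of_bool (p \<in> {a<..b}) + 2 * of_bool (p \<notin> {a..b}) \<le> (2::int)"
    "of_bool (r \<in> {c<..d}) + of_bool (r \<in> {c..<d}) + 2 * of_bool (r \<notin> {c..d}) \<le> (2::int)"
    "of_bool (p + c - r \<in> {a..<b}) + of_bool (r + a - p \<in> {c<..d}) \<le> (1::int)"
    "of_bool (p + d - r \<in> {a<..b}) + of_bool (r + b - p \<in> {c..<d}) \<le> (1::int)"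
    "of_bool (p + r - c \<in> {a..<b}) + of_bool (r + p - b \<in> {c..<d}) \<le> (1::int)"
    "of_bool (r + p - a \<in> {c<..d}) + of_bool (p + r - d \<in> {a<..b}) \<le> (1::int)"
    by (auto simp: of_bool_def)
  moreover note
    card_attacked_in_row_le[OF assms(3), of "{a..<b}", folded p_def r_def]
    card_attacked_in_row_le[OF assms(4), of "{a<..b}", folded p_def r_def]
    card_attacked_in_column_le[OF assms(1), of "{c<..d}", folded p_def r_def]
    card_attacked_in_column_le[OF assms(2), of "{c..<d}", folded p_def r_def]
  ultimately show ?thesis unfolding p_def[symmetric] r_def[symmetric] by linarith
qed

lemma card_le_sum_card_covering:
  assumes "finite A" "finite D" "\<And>x. x \<in> A \<Longrightarrow> \<exists>q\<in>D. P q x"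
  shows "int (card A) \<le> (\<Sum>q\<in>D. int (card {x \<in> A. P q x}))"
proof -
  have "A \<subseteq> (\<Union>q\<in>D. {x \<in> A. P q x})" using assms(3) by blast
  then have "card A \<le> card (\<Union>q\<in>D. {x \<in> A. P q x})"
    using assms(1,2) by (intro card_mono) auto
  also have "\<dots> \<le> (\<Sum>q\<in>D. card {x \<in> A. P q x})" by (rule card_UN_le[OF assms(2)])
  finally show ?thesis by (metis of_nat_le_iff of_nat_sum)
qed

text \<open>Take the least and greatest missed values as \<open>a\<close> and \<open>b\<close>:
  every value of \<open>{1..int N}\<close> beyond them is hit, and distinct values need distinct
  elements of \<open>D\<close>.\<close>

lemma extreme_missed_values:
  fixes f :: "'a \<Rightarrow> int"
  assumes "finite D" "card D < N"
  obtains a b where "1 \<le> a" "a \<le> b" "b \<le> int N" "a \<notin> f ` D" "b \<notin> f ` D"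
    "int N - (b - a) - 1 \<le> (\<Sum>q\<in>D. of_bool (f q \<notin> {a..b}))"
proof -
  define E where "E = {1..int N} - f ` D"
  have fin: "finite E" by (simp add: E_def)
  have "card (f ` D) < card {1..int N}" using assms card_image_le[of D f] by simp
  then have "E \<noteq> {}"
    unfolding E_def using card_mono[of "f ` D" "{1..int N}"] assms(1) by fastforce
  then have Min: "Min E \<in> E" and Max: "Max E \<in> E" using fin by simp_all
  have "x \<in> f ` {q \<in> D. f q \<notin> {Min E..Max E}}" if "x \<in> {1..<Min E} \<union> {Max E<..int N}" for x
  proof -
    have "x \<notin> E" using that Min_le[OF fin, of x] Max_ge[OF fin, of x] by force
    then have "x \<in> f ` D" using that Min Max by (auto simp: E_def)
    then show ?thesis using that by auto
  qed
  then have "card ({1..<Min E} \<union> {Max E<..int N}) \<le> card {q \<in> D. f q \<notin> {Min E..Max E}}"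
    by (intro surj_card_le[where f = f]) (use assms in auto)
  moreover have le: "Min E \<le> Max E" using fin Max by simp
  moreover have "card ({1..<Min E} \<union> {Max E<..int N}) = nat (Min E - 1) + nat (int N - Max E)"
    using le by (subst card_Un_disjoint) auto
  moreover have "(\<Sum>q\<in>D. of_bool (f q \<notin> {Min E..Max E})) = int (card {q \<in> D. f q \<notin> {Min E..Max E}})"
    using assms(1) by (subst sum_of_bool_eq) (auto simp: Int_def)
  moreover have "1 \<le> Min E" "Max E \<le> int N" "Min E \<notin> f ` D" "Max E \<notin> f ` D"
    using Min Max by (auto simp: E_def)
  ultimately show ?thesis by (intro that[of "Min E" "Max E"]) linarith+
qed

lemma dominating_set_queens_graph_bound:
  assumes "finite D" "dominating_set (queens_graph m n) D" "card D < m" "card D < n"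
  shows "int m + int n - 2 \<le> 4 * int (card D)"
proof -
  obtain a b where ab: "1 \<le> a" "a \<le> b" "b \<le> int n" "a \<notin> fst ` D" "b \<notin> fst ` D"
    and outside_columns: "int n - (b - a) - 1 \<le> (\<Sum>q\<in>D. of_bool (fst q \<notin> {a..b}))"
    using extreme_missed_values[of D n fst] assms(1,4) by metis
  obtain c d where cd: "1 \<le> c" "c \<le> d" "d \<le> int m" "c \<notin> snd ` D" "d \<notin> snd ` D"
    and outside_rows: "int m - (d - c) - 1 \<le> (\<Sum>q\<in>D. of_bool (snd q \<notin> {c..d}))"
    using extreme_missed_values[of D m snd] assms(1,3) by metis
  have attacked: "\<exists>q\<in>D. queens_adj q s" if "s \<in> squares m n" "s \<notin> D" for s
    using assms(2) that by (auto simp: dominating_set_def queens_graph_def)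
  \<comment> \<open>A boundary square lies in a row or column free of queens, so it is not in
    \<open>D\<close> and must be attacked.\<close>
  have "int (card {a..<b}) \<le> (\<Sum>q\<in>D. int (card {x \<in> {a..<b}. queens_adj q (x, c)}))"
    "int (card {a<..b}) \<le> (\<Sum>q\<in>D. int (card {x \<in> {a<..b}. queens_adj q (x, d)}))"
    "int (card {c<..d}) \<le> (\<Sum>q\<in>D. int (card {y \<in> {c<..d}. queens_adj q (a, y)}))"
    "int (card {c..<d}) \<le> (\<Sum>q\<in>D. int (card {y \<in> {c..<d}. queens_adj q (b, y)}))"
    by (intro card_le_sum_card_covering attacked;
        use assms(1) ab cd in \<open>force simp: squares_def\<close>)+
  moreover have "(\<Sum>q\<in>D. int (card {x \<in> {a..<b}. queens_adj q (x, c)})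
       + int (card {x \<in> {a<..b}. queens_adj q (x, d)})
       + int (card {y \<in> {c<..d}. queens_adj q (a, y)})
       + int (card {y \<in> {c..<d}. queens_adj q (b, y)})
       + 2 * of_bool (fst q \<notin> {a..b}) + 2 * of_bool (snd q \<notin> {c..d})) \<le> (\<Sum>q\<in>D. 8)"
    using ab cd by (intro sum_mono attacked_boundary_le) auto
  \<comment> \<open>The side lengths \<open>b - a\<close> and \<open>d - c\<close> cancel against
    the counts of outside queens, leaving twice the claim.\<close>
  ultimately show ?thesis
    using outside_columns outside_rows ab(2) cd(2)
    by (simp add: sum.distrib flip: sum_distrib_left)
qed

theorem theorem2:
  fixes m n :: nat
  assumes "1 \<le> m" and "1 \<le> n" and "m \<le> n"
  shows "int (domination_number (queens_graph m n))
           \<ge> min (int m) \<lceil>(real m + real n - 2) / 4\<rceil>"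
proof -
  obtain D where D: "finite D" "dominating_set (queens_graph m n) D"
    and card: "card D = domination_number (queens_graph m n)"
    using domination_number_attained[of "queens_graph m n"] finite_squares
    by (auto simp: queens_graph_def)
  show ?thesis
  proof (cases "card D < m")
    case True
    then have "int m + int n - 2 \<le> 4 * int (card D)"
      using dominating_set_queens_graph_bound[OF D] assms(3) by simp
    then have "\<lceil>(real m + real n - 2) / 4\<rceil> \<le> int (card D)"
      by (simp add: ceiling_le_iff)
    then show ?thesis using card by simp
  qed (use card in auto)
qed

end
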